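(* Let $s<n$ be integers, $X\subseteq\mathbb{R}^n$ closed and convex, $f:\mathbb{R}^n\to\mathbb{R}$ continuously differentiable, and $\rho\in\mathbb{N}$. Let $x^*$ be a global minimum point of the problem $\min\{f(x) : \|x\|_0\le s,\ x\in X\}$. Then $x^*$ is an $\mathcal{N}$-stationary point of this problem (with respect to the neighborhood $\mathcal{N}_\rho$).
   Context: $\|x\|_0$ is the number of nonzero components of $x$, $e$ is the all-ones vector, and $\Pi_C$ is the Euclidean projection onto a nonempty closed convex set $C$. Put $\mathcal{Y}=\{y\in\{0,1\}^n : e^\top y\ge n-s\}$ and, for $y\in\mathcal{Y}$, $\mathcal{X}(y)=\{x\in X : x_iy_i=0\ \forall i=1,\dots,n\}$ (closed and convex). A pair $(x,y)$ is feasible if $y\in\mathcal{Y}$ and $x\in\mathcal{X}(y)$. Stationarity: for $\bar y\in\mathcal{Y}$, a point $\bar x\in\mathcal{X}(\bar y)$ is a stationary point of $\min\{f(x): x\in\mathcal{X}(\bar y)\}$ if $\bar x=\Pi_{\mathcal{X}(\bar y)}[\bar x-\nabla f(\bar x)]$. Neighborhood $\mathcal{N}_\rho$: let $d_H$ be the Hamming distance on $\{0,1\}^n$, $J(y,\hat y)=\{i: y_i\ne\hat y_i\}$, and let $H_{J(y,\hat y)}(x)$ be the vector obtained from $x$ by setting to $0$ all components with index in $J(y,\hat y)$. For a feasible pair $(x,y)$, $\mathcal{N}_\rho(x,y)$ is the set of pairs $(\hat x,\hat y)$ with $\hat y\in\mathcal{Y}$, $\mathcal{X}(\hat y)\neq\emptyset$,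 $d_H(\hat y,y)\le\rho$ and $\hat x=\Pi_{\mathcal{X}(\hat y)}\big(H_{J(y,\hat y)}(x)\big)$ (when $X=\mathbb{R}^n$ the projection leaves the point unchanged). $\mathcal{N}$-stationarity: a point $x^*\in X$ with $\|x^*\|_0\le s$ is $\mathcal{N}$-stationary if there exists $y^*\in\mathcal{Y}$ such that (i) $(x^*,y^* )$ is feasible; (ii) $x^*$ is a stationary point of $\min\{f(x):x\in\mathcal{X}(y^* )\}$; (iii) every $(\hat x,\hat y)\in\mathcal{N}_\rho(x^*,y^* )$ satisfies $f(\hat x)\ge f(x^* )$, and if $f(\hat x)=f(x^* )$ then $\hat x$ is a stationary point of $\min\{f(x):x\in\mathcal{X}(\hat y)\}$. *)

theory Defs
  imports "HOL-Analysis.Analysis"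
begin

definition gradient :: "(real ^ 'n \<Rightarrow> real) \<Rightarrow> real ^ 'n \<Rightarrow> real ^ 'n" where
  "gradient f x = (THE g. GDERIV f x :> g)"

lemma gradient_eqI:
  assumes "GDERIV f x :> g"
  shows "gradient f x = g"
  unfolding gradient_def
proof (rule the_equality)
  fix h
  assume "GDERIV f x :> h"
  then have "(\<lambda>d. d \<bullet> h) = (\<lambda>d. d \<bullet> g)"
    using assms unfolding gderiv_def by (rule has_derivative_unique)
  then have "d \<bullet> h = d \<bullet> g" for d
    by (rule fun_cong)
  then show "h = g"
    using vector_eq_ldot by blast
qed (fact assms)

lemma GDERIV_gradient:
  fixes f :: "real ^ 'n \<Rightarrow> real"
  assumes "f differentiable (at x)"
  shows "GDERIV f x :> gradient f x"
proof -
  obtain D where D: "(f has_derivative D) (at x)"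
    using assms unfolding differentiable_def by blast
  then have "linear D"
    by (rule has_derivative_linear)
  then have "D d = d \<bullet> adjoint D 1" for d
    using adjoint_works[of D d 1] by simp
  then have "D = (\<lambda>d. d \<bullet> adjoint D 1)"
    by (rule ext)
  with D have G: "GDERIV f x :> adjoint D 1"
    unfolding gderiv_def by (rule back_subst)
  show ?thesis
    unfolding gradient_eqI[OF G] by (rule G)
qed

definition continuously_differentiable :: "(real ^ 'n \<Rightarrow> real) \<Rightarrow> bool" where
  "continuously_differentiable f \<longleftrightarrow>
     (\<forall>x. f differentiable (at x)) \<and> continuous_on UNIV (gradient f)"

definition l0norm :: "real ^ 'n \<Rightarrow> nat" where
  "l0norm x = card {i. x $ i \<noteq> 0}"

text \<open>
  Binary vectors are real vectors with entries in {0, 1}; the vector \<open>1\<close> is the all-ones vector,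
  and the dimension is \<open>CARD('n)\<close>. The sparsity bound \<open>s\<close> is an integer, so that
  the difference of the dimension and \<open>s\<close> is not truncated.
\<close>

definition binary_set :: "int \<Rightarrow> (real ^ 'n) set" where
  "binary_set s =
     {y. (\<forall>i. y $ i \<in> {0, 1}) \<and> 1 \<bullet> y \<ge> real CARD('n) - real_of_int s}"

definition restricted_set :: "(real ^ 'n) set \<Rightarrow> real ^ 'n \<Rightarrow> (real ^ 'n) set" where
  "restricted_set X y = {x \<in> X. \<forall>i. x $ i * y $ i = 0}"

definition feasible_pair ::
    "(real ^ 'n) set \<Rightarrow> int \<Rightarrow> real ^ 'n \<Rightarrow> real ^ 'n \<Rightarrow> bool" where
  "feasible_pair X s x y \<longleftrightarrow> y \<in> binary_set s \<and> x \<in> restricted_set X y"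

text \<open>
  \<open>closest_point C\<close> is the Euclidean projection when \<open>C\<close> is nonempty, closed and convex.
\<close>

definition stationary_point ::
    "(real ^ 'n \<Rightarrow> real) \<Rightarrow> (real ^ 'n) set \<Rightarrow> real ^ 'n \<Rightarrow> bool" where
  "stationary_point f C x \<longleftrightarrow> x \<in> C \<and> x = closest_point C (x - gradient f x)"

definition diff_set :: "real ^ 'n \<Rightarrow> real ^ 'n \<Rightarrow> 'n set" where
  "diff_set y y' = {i. y $ i \<noteq> y' $ i}"

definition hamming_dist :: "real ^ 'n \<Rightarrow> real ^ 'n \<Rightarrow> nat" where
  "hamming_dist y y' = card (diff_set y y')"

definition zero_out :: "'n set \<Rightarrow> real ^ 'n \<Rightarrow> real ^ 'n" where
  "zero_out J x = (\<chi> i. if i \<in> J then 0 else x $ i)"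

text \<open>
  The neighborhood is meaningful for feasible pairs \<open>(x, y)\<close> only, and it is only used for those.
\<close>

definition neighborhood ::
    "(real ^ 'n) set \<Rightarrow> int \<Rightarrow> nat \<Rightarrow> real ^ 'n \<Rightarrow> real ^ 'n \<Rightarrow> ((real ^ 'n) \<times> (real ^ 'n)) set" where
  "neighborhood X s \<rho> x y =
     {(x', y'). y' \<in> binary_set s \<and> restricted_set X y' \<noteq> {} \<and> hamming_dist y' y \<le> \<rho> \<and>
        x' = closest_point (restricted_set X y') (zero_out (diff_set y y') x)}"

definition N_stationary ::
    "(real ^ 'n \<Rightarrow> real) \<Rightarrow> (real ^ 'n) set \<Rightarrow> int \<Rightarrow> nat \<Rightarrow> real ^ 'n \<Rightarrow> bool" where
  "N_stationary f X s \<rho> x \<longleftrightarrow>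
     x \<in> X \<and> int (l0norm x) \<le> s \<and>
     (\<exists>y \<in> binary_set s.
        feasible_pair X s x y \<and>
        stationary_point f (restricted_set X y) x \<and>
        (\<forall>(x', y') \<in> neighborhood X s \<rho> x y.
           f x' \<ge> f x \<and>
           (f x' = f x \<longrightarrow> stationary_point f (restricted_set X y') x')))"

end

theory Submission
  imports Defs
begin

text \<open>
  Every point of \<open>restricted_set X y\<close> with \<open>y \<in> binary_set s\<close> has at most \<open>s\<close> nonzero components,
  so a global minimum point of the sparse problem minimizes \<open>f\<close> over each of these convex sets that
  contains it, and so does any neighbor with the same value. A minimum point over a convex set
  satisfies the variational inequality, which characterizes the fixed points of the projected
  gradient step. For \<open>y\<close> one takes the indicator of the zero components of the minimum point.
\<close>

text \<open>If the slope of \<open>f\<close> at \<open>x\<close> towards \<open>z\<close> were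
  negative, \<open>f\<close> would drop below \<open>f x\<close> on the segment from
  \<open>x\<close> to \<open>z\<close>, which convexity keeps inside \<open>C\<close>.\<close>

lemma minimum_variational_inequality:
  fixes f :: "real ^ 'n \<Rightarrow> real"
  assumes "f differentiable (at x)" and "convex C" and "x \<in> C" and "z \<in> C"
    and min: "\<And>w. w \<in> C \<Longrightarrow> f x \<le> f w"
  shows "0 \<le> (z - x) \<bullet> gradient f x"
proof (rule ccontr)
  define h where "h t = f (x + t *\<^sub>R (z - x))" for t :: real
  assume "\<not> 0 \<le> (z - x) \<bullet> gradient f x"
  then have neg: "(z - x) \<bullet> gradient f x < 0"
    by simp
  \<comment> \<open>The term \<open>0 *\<^sub>R (z - x)\<close> is kept so that the base point has
    the form the chain rule expects at \<open>t = 0\<close>.\<close>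
  have "(f has_derivative (\<lambda>d. d \<bullet> gradient f x)) (at (x + 0 *\<^sub>R (z - x)))"
    using GDERIV_gradient[OF assms(1)] by (simp add: gderiv_def)
  moreover have "((\<lambda>t. x + t *\<^sub>R (z - x)) has_derivative (\<lambda>t. t *\<^sub>R (z - x))) (at 0)"
    by (auto intro!: derivative_eq_intros)
  ultimately have "(h has_derivative (\<lambda>t. (t *\<^sub>R (z - x)) \<bullet> gradient f x)) (at 0)"
    unfolding h_def by (rule has_derivative_compose[rotated])
  then have "DERIV h 0 :> (z - x) \<bullet> gradient f x"
    by (simp add: has_field_derivative_def mult_commute_abs)
  from DERIV_neg_dec_right[OF this neg] obtain d where "d > 0"
    and d: "\<And>t. 0 < t \<Longrightarrow> t < d \<Longrightarrow> h t < h 0"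
    by auto
  \<comment> \<open>Halving \<open>d\<close> keeps \<open>t\<close> strictly below it; the cap at 1
    keeps the point on the segment.\<close>
  define t where "t = min (d / 2) 1"
  have t: "0 < t" "t < d" "t \<le> 1"
    using \<open>d > 0\<close> by (auto simp: t_def)
  have "x + t *\<^sub>R (z - x) = (1 - t) *\<^sub>R x + t *\<^sub>R z"
    by (simp add: algebra_simps)
  also have "\<dots> \<in> C"
    using assms(2-4) t by (simp add: convex_alt)
  finally have "f x \<le> h t"
    unfolding h_def by (rule min)
  with d[OF t(1,2)] show False
    by (simp add: h_def)
qed

lemma minimum_stationary_point:
  fixes f :: "real ^ 'n \<Rightarrow> real"
  assumes "f differentiable (at x)" and "convex C" and "closed C" and "x \<in> C"
    and "\<And>w. w \<in> C \<Longrightarrow> f x \<le> f w"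
  shows "stationary_point f C x"
proof -
  have "dist (x - gradient f x) x \<le> dist (x - gradient f x) z" if "z \<in> C" for z
  proof -
    have "0 \<le> (z - x) \<bullet> gradient f x"
      using minimum_variational_inequality assms that by blast
    \<comment> \<open>The variational inequality makes the cross term nonnegative, so no point of
      \<open>C\<close> is closer to \<open>x - gradient f x\<close> than \<open>x\<close>.\<close>
    moreover have "(norm (x - gradient f x - z))\<^sup>2
        = (norm (gradient f x))\<^sup>2 + (norm (z - x))\<^sup>2 + 2 * ((z - x) \<bullet> gradient f x)"
      by (simp add: power2_norm_eq_inner algebra_simps inner_commute)
    ultimately have "(norm (gradient f x))\<^sup>2 \<le> (norm (x - gradient f x - z))\<^sup>2"
      by simp
    then have "norm (gradient f x) \<le> norm (x - gradient f x - z)"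
      by (rule power2_le_imp_le) simp
    then show ?thesis
      by (simp add: dist_norm)
  qed
  then have "x = closest_point C (x - gradient f x)"
    using assms(2-4) by (intro closest_point_unique) auto
  with assms(4) show ?thesis
    unfolding stationary_point_def by blast
qed

text \<open>Each factor is a coordinate hyperplane, or the whole space if \<open>y $ i = 0\<close>,
  so \<open>X\<close> passes on closedness and convexity.\<close>

lemma restricted_set_eq_Int:
  "restricted_set X y = X \<inter> (\<Inter>i. {x. axis i (y $ i) \<bullet> x = 0})"
  by (auto simp: restricted_set_def inner_axis' mult.commute)

lemma closed_restricted_set: "closed X \<Longrightarrow> closed (restricted_set X y)"
  unfolding restricted_set_eq_Int by (intro closed_Int closed_INT ballI closed_hyperplane)

lemma convex_restricted_set: "convex X \<Longrightarrow> convex (restricted_set X y)"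
  unfolding restricted_set_eq_Int by (intro convex_Int convex_INT ballI convex_hyperplane)

text \<open>Turns the bound on \<open>1 \<bullet> y\<close> in \<open>binary_set\<close> into: at
  most \<open>s\<close> zero entries.\<close>

lemma inner_one_binary:
  fixes y :: "real ^ 'n"
  assumes "\<And>i. y $ i \<in> {0, 1}"
  shows "1 \<bullet> y = real CARD('n) - real (card {i. y $ i = 0})"
proof -
  have "y $ i = 1 - of_bool (y $ i = 0)" for i
    using assms[of i] by auto
  then have "1 \<bullet> y = (\<Sum>i\<in>UNIV. 1 - of_bool (y $ i = 0))"
    by (simp add: inner_vec_def)
  then show ?thesis
    by (simp add: sum_subtractf)
qed

text \<open>The support of \<open>x\<close> lies in the zero set of \<open>y\<close>.\<close>

lemma l0norm_restricted_set_le: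
  assumes "y \<in> binary_set s" and "x \<in> restricted_set X y"
  shows "int (l0norm x) \<le> s"
proof -
  have "l0norm x \<le> card {i. y $ i = 0}"
    using assms(2) by (auto simp: l0norm_def restricted_set_def intro!: card_mono)
  moreover have "real (card {i. y $ i = 0}) \<le> real_of_int s"
    using assms(1) inner_one_binary[of y] by (auto simp: binary_set_def)
  ultimately show ?thesis
    by linarith
qed

text \<open>The zero set of the indicator is exactly the support of \<open>x\<close>.\<close>

lemma feasible_pair_zero_indicator:
  fixes x :: "real ^ 'n"
  assumes "x \<in> X" and "int (l0norm x) \<le> s"
  shows "feasible_pair X s x (\<chi> i. of_bool (x $ i = 0))"
proof -
  have "1 \<bullet> (\<chi> i. of_bool (x $ i = 0) :: real ^ 'n) = real CARD('n) - real (l0norm x)"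
    by (subst inner_one_binary) (simp_all add: l0norm_def)
  moreover have "real (l0norm x) \<le> real_of_int s"
    using assms(2) by linarith
  ultimately show ?thesis
    using assms(1) by (auto simp: feasible_pair_def binary_set_def restricted_set_def)
qed

theorem theorem2p5:
  fixes f :: "real ^ 'n \<Rightarrow> real"
    and X :: "(real ^ 'n) set"
    and s :: int
    and \<rho> :: nat
    and xstar :: "real ^ 'n"
  assumes "s < int CARD('n)"
    and "closed X"
    and "convex X"
    and "continuously_differentiable f"
    and "is_arg_min f (\<lambda>x. int (l0norm x) \<le> s \<and> x \<in> X) xstar"
  shows "N_stationary f X s \<rho> xstar"
proof -
  have xstar: "xstar \<in> X" "int (l0norm xstar) \<le> s"
    using assms(5) by (auto simp: is_arg_min_def)
  have min: "f xstar \<le> f w" if "y \<in> binary_set s" "w \<in> restricted_set X y" for y w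
    using assms(5) l0norm_restricted_set_le[OF that] that(2)
    by (auto simp: is_arg_min_linorder restricted_set_def)
  \<comment> \<open>Serves both \<open>xstar\<close> itself and the neighbors that tie with
    it.\<close>
  have stationary: "stationary_point f (restricted_set X y) x"
    if "y \<in> binary_set s" "x \<in> restricted_set X y" "f x = f xstar" for x y
    using assms(2-4) that min
    by (intro minimum_stationary_point closed_restricted_set convex_restricted_set)
      (auto simp: continuously_differentiable_def)
  define y :: "real ^ 'n" where "y = (\<chi> i. of_bool (xstar $ i = 0))"
  have feasible: "feasible_pair X s xstar y"
    unfolding y_def by (rule feasible_pair_zero_indicator[OF xstar])
  then have y: "y \<in> binary_set s" "xstar \<in> restricted_set X y"
    by (auto simp: feasible_pair_def)
  have "f x' \<ge> f xstar \<and> (f x' = f xstar \<longrightarrow> stationary_point f (restricted_set X y') x')"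
    if "(x', y') \<in> neighborhood X s \<rho> xstar y" for x' y'
  proof -
    \<comment> \<open>The projection onto a nonempty closed set lies in that set, so
      \<open>x'\<close> competes with \<open>xstar\<close>.\<close>
    have y': "y' \<in> binary_set s" and "x' \<in> restricted_set X y'"
      using that closed_restricted_set[OF assms(2)]
      by (auto simp: neighborhood_def intro: closest_point_in_set)
    then show ?thesis
      using min stationary by blast
  qed
  with xstar y feasible stationary[OF y] show ?thesis
    unfolding N_stationary_def by blast
qed

end
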